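(* Let $\mathcal{H},\mathcal{F}\in\mathfrak{C}^1([-1,1])$ and $r_0>0$, and consider the prescribed mean curvature catenoids $\Sigma_{\mathcal{H}}(r_0)$ and $\Sigma_{\mathcal{F}}(r_0)$. If $\mathcal{H}\sim_1\mathcal{F}$, then $\Sigma_{\mathcal{H}}(r_0)$ has bounded (resp. unbounded) upper height if and only if $\Sigma_{\mathcal{F}}(r_0)$ has bounded (resp. unbounded) upper height. If $\mathcal{H}\sim_{-1}\mathcal{F}$, then $\Sigma_{\mathcal{H}}(r_0)$ has bounded (resp. unbounded) lower height if and only if $\Sigma_{\mathcal{F}}(r_0)$ has bounded (resp. unbounded) lower height.
   Context: $\mathfrak{C}^1([-1,1]):=\{\mathcal{H}\in C^1([-1,1]):\ \mathcal{H}(y)<0\ \text{for all } y\in(-1,1),\ \mathcal{H}(-1)=\mathcal{H}(1)=0\}$. For $\mathcal{H}\in\mathfrak{C}^1([-1,1])$, an $\mathcal{H}$-surface is an immersed oriented surface $\Sigma\subset\mathbb{R}^3$ with unit normal $\eta$ whose mean curvature (half the sum of principal curvatures) is $H_\Sigma=\mathcal{H}(\langle\eta,e_3\rangle)$, $e_3=(0,0,1)$. For every $r_0>0$ the $\mathcal{H}$-catenoid $\Sigma_{\mathcal{H}}(r_0)$ is the (known to exist and unique) properly embedded annular $\mathcal{H}$-surface, rotationally symmetric about the $z$-axis, which is a bi-graph over the exterior of the disk $D(0,r_0)$ in $\{z=0\}$, meeting $\{z=0\}$ orthogonally along its waist, the circle of radius $r_0$ (its necksize); its unit normal points inwards at the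 waist, upwards on the upper end $\Sigma_{\mathcal{H}}^+(r_0)=\Sigma_{\mathcal{H}}(r_0)\cap\{z\ge0\}$ and downwards on the lower end $\Sigma_{\mathcal{H}}^-(r_0)=\Sigma_{\mathcal{H}}(r_0)\cap\{z\le0\}$. The upper and lower ends are obtained by rotating about the $z$-axis the graphs $z=f_+(x)$ and $z=f_-(x)$, $x>r_0$, where $f_+$ (upper height) and $f_-$ (lower height) satisfy $$2\mathcal{H}\Big(\tfrac{1}{\sqrt{1+f_+'^2}}\Big)=\frac{f_+''}{(1+f_+'^2)^{3/2}}+\frac{f_+'}{x\sqrt{1+f_+'^2}},\qquad -2\mathcal{H}\Big(\tfrac{-1}{\sqrt{1+f_-'^2}}\Big)=\frac{f_-''}{(1+f_-'^2)^{3/2}}+\frac{f_-'}{x\sqrt{1+f_-'^2}},$$ with $f_\pm(x)\to0$ and $f_\pm'(x)\to\pm\infty$ as $x\to r_0^+$. $\Sigma_{\mathcal{H}}(r_0)$ has unbounded (bounded) upper height if $f_+$ is unbounded (bounded) on $(r_0,\infty)$, and unbounded (bounded) lower height if $f_-$ is unbounded (bounded). For $\mathcal{H},\mathcal{F}\in\mathfrak{C}^1([-1,1])$: $\mathcal{H}\sim_1\mathcal{F}$ means $\lim_{y\to1}\mathcal{H}(y)/\mathcal{F}(y)=C_1$ for some nonzero constant $C_1$; $\mathcal{H}\sim_{-1}\mathcal{F}$ means $\lim_{y\to-1}\mathcal{H}(y)/\mathcal{F}(y)=C_2$ for some nonzero constant $C_2$. *)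

theory Defs
  imports "HOL-Analysis.Analysis"
begin

section \<open>Prescribing functions\<close>

text \<open>The derivative on the closed interval is one-sided at the end points.\<close>

definition C1_class :: "(real \<Rightarrow> real) set" where
  "C1_class = {\<H>.
     (\<exists>\<H>'. (\<forall>y\<in>{-1..1}. (\<H> has_real_derivative \<H>' y) (at y within {-1..1})) \<and>
           continuous_on {-1..1} \<H>') \<and>
     (\<forall>y\<in>{-1<..<1}. \<H> y < 0) \<and> \<H> (-1) = 0 \<and> \<H> 1 = 0}"

definition sim_1 :: "(real \<Rightarrow> real) \<Rightarrow> (real \<Rightarrow> real) \<Rightarrow> bool"  (infix "\<sim>\<^sub>1" 50) where
  "\<H> \<sim>\<^sub>1 \<F> \<longleftrightarrow> (\<exists>C. C \<noteq> 0 \<and> ((\<lambda>y. \<H> y / \<F> y) \<longlongrightarrow> C) (at_left 1))"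

definition sim_m1 :: "(real \<Rightarrow> real) \<Rightarrow> (real \<Rightarrow> real) \<Rightarrow> bool"  (infix "\<sim>\<^sub>-\<^sub>1" 50) where
  "\<H> \<sim>\<^sub>-\<^sub>1 \<F> \<longleftrightarrow> (\<exists>C. C \<noteq> 0 \<and> ((\<lambda>y. \<H> y / \<F> y) \<longlongrightarrow> C) (at_right (-1)))"

section \<open>Embedded surfaces in three-space\<close>

definition pd1 :: "(real \<times> real \<Rightarrow> real ^ 3) \<Rightarrow> real \<times> real \<Rightarrow> real ^ 3" where
  "pd1 X q = frechet_derivative X (at q) (1, 0)"

definition pd2 :: "(real \<times> real \<Rightarrow> real ^ 3) \<Rightarrow> real \<times> real \<Rightarrow> real ^ 3" where
  "pd2 X q = frechet_derivative X (at q) (0, 1)"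

definition C2_map_on :: "(real \<times> real) set \<Rightarrow> (real \<times> real \<Rightarrow> real ^ 3) \<Rightarrow> bool" where
  "C2_map_on U X \<longleftrightarrow>
     X differentiable_on U \<and> pd1 X differentiable_on U \<and> pd2 X differentiable_on U \<and>
     continuous_on U (pd1 (pd1 X)) \<and> continuous_on U (pd1 (pd2 X)) \<and>
     continuous_on U (pd2 (pd1 X)) \<and> continuous_on U (pd2 (pd2 X))"

definition local_chart ::
    "(real ^ 3) set \<Rightarrow> (real \<times> real) set \<Rightarrow> (real \<times> real \<Rightarrow> real ^ 3) \<Rightarrow> bool" where
  "local_chart \<Sigma> U X \<longleftrightarrow>
     open U \<and> C2_map_on U X \<and> (\<forall>q\<in>U. inj (frechet_derivative X (at q))) \<and>
     openin (top_of_set \<Sigma>) (X ` U) \<and> (\<exists>Y. homeomorphism U (X ` U) X Y)"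

definition embedded_surface :: "(real ^ 3) set \<Rightarrow> bool" where
  "embedded_surface \<Sigma> \<longleftrightarrow> (\<forall>p\<in>\<Sigma>. \<exists>U X. local_chart \<Sigma> U X \<and> p \<in> X ` U)"

text \<open>A unit normal field is continuous, so it fixes an orientation.\<close>

definition unit_normal :: "(real ^ 3) set \<Rightarrow> (real ^ 3 \<Rightarrow> real ^ 3) \<Rightarrow> bool" where
  "unit_normal \<Sigma> \<eta> \<longleftrightarrow>
     continuous_on \<Sigma> \<eta> \<and> (\<forall>p\<in>\<Sigma>. norm (\<eta> p) = 1) \<and>
     (\<forall>U X. local_chart \<Sigma> U X \<longrightarrow>
        (\<forall>q\<in>U. \<eta> (X q) \<bullet> pd1 X q = 0 \<and> \<eta> (X q) \<bullet> pd2 X q = 0))"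

definition first_form :: "(real \<times> real \<Rightarrow> real ^ 3) \<Rightarrow> real \<times> real \<Rightarrow> real ^ 2 ^ 2" where
  "first_form X q = vector [vector [pd1 X q \<bullet> pd1 X q, pd1 X q \<bullet> pd2 X q],
                            vector [pd2 X q \<bullet> pd1 X q, pd2 X q \<bullet> pd2 X q]]"

definition second_form ::
    "(real ^ 3 \<Rightarrow> real ^ 3) \<Rightarrow> (real \<times> real \<Rightarrow> real ^ 3) \<Rightarrow> real \<times> real \<Rightarrow> real ^ 2 ^ 2" where
  "second_form \<eta> X q = vector [vector [pd1 (pd1 X) q \<bullet> \<eta> (X q), pd1 (pd2 X) q \<bullet> \<eta> (X q)],
                               vector [pd2 (pd1 X) q \<bullet> \<eta> (X q), pd2 (pd2 X) q \<bullet> \<eta> (X q)]]"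

text \<open>The principal curvatures are the eigenvalues, with multiplicity, of the shape operator
  \<open>- d\<eta>\<close>, whose matrix in a chart is the inverse of the first fundamental form times the second.
  Hence \<open>k\<^sub>1, k\<^sub>2\<close> are the two roots of \<open>det (II - t I) = 0\<close>.\<close>

definition principal_curvatures ::
    "(real ^ 3 \<Rightarrow> real ^ 3) \<Rightarrow> (real \<times> real \<Rightarrow> real ^ 3) \<Rightarrow> real \<times> real \<Rightarrow> real \<Rightarrow> real \<Rightarrow> bool" where
  "principal_curvatures \<eta> X q k\<^sub>1 k\<^sub>2 \<longleftrightarrow>
     (\<forall>t. det (second_form \<eta> X q - t *\<^sub>R first_form X q) =
          det (first_form X q) * ((k\<^sub>1 - t) * (k\<^sub>2 - t)))"

definition has_mean_curvature ::
    "(real ^ 3 \<Rightarrow> real ^ 3) \<Rightarrow> (real \<times> real \<Rightarrow> real ^ 3) \<Rightarrow> real \<times> real \<Rightarrow> real \<Rightarrow> bool" where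
  "has_mean_curvature \<eta> X q h \<longleftrightarrow>
     (\<exists>k\<^sub>1 k\<^sub>2. principal_curvatures \<eta> X q k\<^sub>1 k\<^sub>2 \<and> h = (k\<^sub>1 + k\<^sub>2) / 2)"

definition e3 :: "real ^ 3" where
  "e3 = vector [0, 0, 1]"

text \<open>Quantifying over all charts is harmless: the mean curvature with respect to \<open>\<eta>\<close> does not
  depend on the chart.\<close>

definition H_surface ::
    "(real \<Rightarrow> real) \<Rightarrow> (real ^ 3) set \<Rightarrow> (real ^ 3 \<Rightarrow> real ^ 3) \<Rightarrow> bool" where
  "H_surface \<H> \<Sigma> \<eta> \<longleftrightarrow>
     embedded_surface \<Sigma> \<and> unit_normal \<Sigma> \<eta> \<and>
     (\<forall>U X. local_chart \<Sigma> U X \<longrightarrow>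
        (\<forall>q\<in>U. has_mean_curvature \<eta> X q (\<H> (\<eta> (X q) \<bullet> e3))))"

section \<open>Catenoids and their heights\<close>

definition axis_dist :: "real ^ 3 \<Rightarrow> real" where
  "axis_dist p = sqrt ((p $ 1)\<^sup>2 + (p $ 2)\<^sup>2)"

definition rotated_graph :: "real \<Rightarrow> (real \<Rightarrow> real) \<Rightarrow> (real ^ 3) set" where
  "rotated_graph r0 f = {p. axis_dist p > r0 \<and> p $ 3 = f (axis_dist p)}"

definition waist :: "real \<Rightarrow> (real ^ 3) set" where
  "waist r0 = {p. axis_dist p = r0 \<and> p $ 3 = 0}"

text \<open>The ends meet the plane \<open>z = 0\<close> in the waist only, so the strict inequalities remove exactly
  the waist. The profile \<open>f\<close> is determined on \<open>x > r0\<close> by the surface.\<close>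

definition upper_profile :: "real \<Rightarrow> (real ^ 3) set \<Rightarrow> (real \<Rightarrow> real) \<Rightarrow> bool" where
  "upper_profile r0 \<Sigma> f \<longleftrightarrow> \<Sigma> \<inter> {p. p $ 3 > 0} = rotated_graph r0 f"

definition lower_profile :: "real \<Rightarrow> (real ^ 3) set \<Rightarrow> (real \<Rightarrow> real) \<Rightarrow> bool" where
  "lower_profile r0 \<Sigma> f \<longleftrightarrow> \<Sigma> \<inter> {p. p $ 3 < 0} = rotated_graph r0 f"

definition C2_profile :: "real \<Rightarrow> (real \<Rightarrow> real) \<Rightarrow> bool" where
  "C2_profile r0 f \<longleftrightarrow>
     f differentiable_on {r0<..} \<and> deriv f differentiable_on {r0<..} \<and>
     continuous_on {r0<..} (deriv (deriv f)) \<and> (f \<longlongrightarrow> 0) (at_right r0)"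

text \<open>Properly embedded means embedded and closed in space. Rotational symmetry is contained in
  the profile conditions and the form of the waist. At the waist the normal is the horizontal
  inward unit vector, which says that the surface meets the plane \<open>z = 0\<close> orthogonally. The
  equations for the profiles and the blow-up of their slopes at \<open>r0\<close> are not imposed: they express
  \<open>H_surface\<close> in the coordinates of the profiles and the continuity of the normal at the waist.\<close>

definition H_catenoid :: "(real \<Rightarrow> real) \<Rightarrow> real \<Rightarrow> (real ^ 3) set \<Rightarrow> bool" where
  "H_catenoid \<H> r0 \<Sigma> \<longleftrightarrow>
     closed \<Sigma> \<and> \<Sigma> homeomorphic (sphere (0::complex) 1 \<times> (UNIV :: real set)) \<and>
     \<Sigma> \<inter> {p. p $ 3 = 0} = waist r0 \<and>
     (\<exists>f. upper_profile r0 \<Sigma> f \<and> C2_profile r0 f) \<and>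
     (\<exists>f. lower_profile r0 \<Sigma> f \<and> C2_profile r0 f) \<and>
     (\<exists>\<eta>. H_surface \<H> \<Sigma> \<eta> \<and>
        (\<forall>p\<in>waist r0. \<eta> p = - (p /\<^sub>R r0)) \<and>
        (\<forall>p\<in>\<Sigma>. p $ 3 > 0 \<longrightarrow> \<eta> p \<bullet> e3 > 0) \<and>
        (\<forall>p\<in>\<Sigma>. p $ 3 < 0 \<longrightarrow> \<eta> p \<bullet> e3 < 0))"

definition bounded_upper_height :: "real \<Rightarrow> (real ^ 3) set \<Rightarrow> bool" where
  "bounded_upper_height r0 \<Sigma> \<longleftrightarrow> (\<exists>f. upper_profile r0 \<Sigma> f \<and> bounded (f ` {r0<..}))"

definition unbounded_upper_height :: "real \<Rightarrow> (real ^ 3) set \<Rightarrow> bool" where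
  "unbounded_upper_height r0 \<Sigma> \<longleftrightarrow> (\<exists>f. upper_profile r0 \<Sigma> f \<and> \<not> bounded (f ` {r0<..}))"

definition bounded_lower_height :: "real \<Rightarrow> (real ^ 3) set \<Rightarrow> bool" where
  "bounded_lower_height r0 \<Sigma> \<longleftrightarrow> (\<exists>f. lower_profile r0 \<Sigma> f \<and> bounded (f ` {r0<..}))"

definition unbounded_lower_height :: "real \<Rightarrow> (real ^ 3) set \<Rightarrow> bool" where
  "unbounded_lower_height r0 \<Sigma> \<longleftrightarrow> (\<exists>f. lower_profile r0 \<Sigma> f \<and> \<not> bounded (f ` {r0<..}))"

end

theory Submission
  imports Defs
begin

text \<open>The graph of \<open>f\<close> sweeps out an end of an \<open>\<H>\<close>-catenoid only if its slope \<open>p = f'\<close> satisfies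
  \<open>p' = w\<^sup>2 (2 w \<H>(1/w) - p/x)\<close>, where \<open>w = (1 + p\<^sup>2)\<^bsup>1/2\<^esup>\<close>,
  and the lower end satisfies the same equation with \<open>- f\<close> and \<open>y \<mapsto> \<H>(-y)\<close> in place of \<open>f\<close> and \<open>\<H>\<close>
  (lemma \<open>height_profile_of_rotated_graph\<close>). So only the upper end matters.

  The slope is positive and tends to \<open>0\<close> (lemmas \<open>slope_positive\<close> and \<open>slope_tendsto_0\<close>). Therefore the
  normal tends to the vertical, and only the behaviour of \<open>\<H>\<close> near \<open>1\<close> influences the height far out.
  There the assumption on the quotient compares \<open>\<H>\<close> and \<open>\<F>\<close> up to a constant factor, in both directions.

  Constant factors are absorbed by a homothety: if \<open>q\<close> is the slope for \<open>\<F>\<close>, then \<open>q (m x)\<close> is the slope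
  for \<open>m \<F>\<close>. If \<open>\<H> > c \<F>\<close> near \<open>1\<close>, then for every large \<open>m\<close> also \<open>\<H> > m \<F>\<close>, because \<open>\<F>\<close> is negative;
  thus the slope \<open>q (m x)\<close> decreases faster than \<open>p x\<close> wherever they coincide, and stays below once it is
  below. It is below at a given point if \<open>m\<close> is large, since \<open>q\<close> tends to \<open>0\<close> (lemma \<open>slope_comparison\<close>).
  Integrating, a bounded height for \<open>\<H>\<close> yields a bounded height for \<open>\<F>\<close> (lemma
  \<open>bounded_height_if_dominated\<close>), and the converse follows by exchanging the roles of \<open>\<H>\<close> and \<open>\<F>\<close>.\<close>

section \<open>The slope equation and comparison of heights\<close>

text \<open>A first zero of \<open>g\<close> would be reached from above, with \<open>g' \<le> 0\<close> there. Both comparison arguments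
  below have this form, and the strict inequality at zeros takes the place of uniqueness of solutions.\<close>

lemma positive_if_increasing_at_zeros:
  fixes g g' :: "real \<Rightarrow> real"
  assumes der: "\<And>x. a \<le> x \<Longrightarrow> (g has_real_derivative g' x) (at x)"
    and start: "g a > 0"
    and zero: "\<And>x. a \<le> x \<Longrightarrow> g x = 0 \<Longrightarrow> g' x > 0"
    and "a \<le> x"
  shows "g x > 0"
proof (rule ccontr)
  assume neg: "\<not> g x > 0"
  define Z where "Z = {a..x} \<inter> g -` {..0}"
  have cont: "continuous_on {a..x} g"
    using der by (meson DERIV_isCont atLeastAtMost_iff continuous_at_imp_continuous_on)
  have "closed Z"
    unfolding Z_def by (intro continuous_closed_preimage cont) auto
  moreover have "Z \<noteq> {}" "bdd_below Z"
    using neg \<open>a \<le> x\<close> by (auto simp: Z_def bdd_below_def)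
  ultimately have zZ: "Inf Z \<in> Z" and least: "\<And>y. y \<in> Z \<Longrightarrow> Inf Z \<le> y"
    by (auto intro: closed_contains_Inf cInf_lower)
  define z where "z = Inf Z"
  have z: "a \<le> z" "z \<le> x" "g z \<le> 0"
    using zZ by (auto simp: Z_def z_def)
  have "\<exists>y\<ge>a. y \<le> z \<and> g y = 0"
    using z start cont by (intro IVT2') (auto intro: continuous_on_subset)
  then obtain y where y: "a \<le> y" "y \<le> z" "g y = 0"
    by blast
  with z have "y \<in> Z"
    by (auto simp: Z_def)
  with y least have "g z = 0"
    by (force simp: z_def)
  with z start have "a < z"
    by (cases "a = z") auto
  have "g' z > 0"
    using zero z \<open>g z = 0\<close> by blast
  from DERIV_pos_inc_left[OF der[OF z(1)] this]
  obtain d where d: "d > 0" "\<And>h. h > 0 \<Longrightarrow> h < d \<Longrightarrow> g (z - h) < g z"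
    by blast
  define h where "h = min (d / 2) (z - a)"
  have h: "0 < h" "h < d" "a \<le> z - h"
    using \<open>d > 0\<close> \<open>a < z\<close> by (auto simp: h_def)
  then have "z - h \<in> Z"
    using d(2)[of h] z \<open>g z = 0\<close> by (auto simp: Z_def)
  with least[of "z - h"] h show False
    by (simp add: z_def)
qed

text \<open>Since \<open>f''/(1 + f'\<^sup>2)\<^bsup>3/2\<^esup> + f'/(x (1 + f'\<^sup>2)\<^bsup>1/2\<^esup>)\<close> is twice the mean curvature
  of the surface swept out by the graph of \<open>f\<close>, prescribing the latter as \<open>h\<close> of the height \<open>1/(1 + P\<^sup>2)\<^bsup>1/2\<^esup>\<close>
  of the normal and solving for \<open>f''\<close> gives this value at \<open>x\<close> when \<open>f' = P\<close>.\<close>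

definition slope_field :: "(real \<Rightarrow> real) \<Rightarrow> real \<Rightarrow> real \<Rightarrow> real" where
  "slope_field h x P = (1 + P\<^sup>2) * (2 * sqrt (1 + P\<^sup>2) * h (1 / sqrt (1 + P\<^sup>2)) - P / x)"

definition slope_equation :: "(real \<Rightarrow> real) \<Rightarrow> real \<Rightarrow> (real \<Rightarrow> real) \<Rightarrow> bool" where
  "slope_equation h r0 p \<longleftrightarrow>
     (\<forall>x>r0. (p has_real_derivative slope_field h x (p x)) (at x))"

text \<open>The linear bound comes from the \<open>C\<^sup>1\<close> regularity up to the end point, where a prescribing function
  vanishes. It makes \<open>h\<close> of the height of the normal a term of second order in the slope.\<close>

definition prescribes_near_1 :: "(real \<Rightarrow> real) \<Rightarrow> bool" where
  "prescribes_near_1 h \<longleftrightarrow>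
     (\<forall>y\<in>{0<..<1}. h y < 0) \<and> (\<exists>L\<ge>0. \<forall>y\<in>{0<..1}. - h y \<le> L * (1 - y))"

lemma normal_height_in_interval:
  fixes t :: real
  assumes "t \<noteq> 0"
  shows "1 / sqrt (1 + t\<^sup>2) \<in> {0<..<1}"
  using assms by (auto simp: add_pos_nonneg)

text \<open>For small slopes \<open>P\<close> the equation gives \<open>P' \<ge> - (const) P\<close>, because \<open>h\<close> of the height of the
  normal is \<open>O(P\<^sup>2)\<close>. So an exponential that decays fast enough stays below the slope.\<close>

lemma slope_positive:
  assumes ode: "slope_equation h r0 p" and h: "prescribes_near_1 h"
    and "0 < r0" "r0 < a" "p a > 0" "a \<le> x"
  shows "p x > 0"
proof -
  obtain L where L: "L \<ge> 0" "\<And>y. 0 < y \<Longrightarrow> y \<le> 1 \<Longrightarrow> - h y \<le> L * (1 - y)"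
    using h by (auto simp: prescribes_near_1_def)
  \<comment> \<open>The barrier \<open>b\<close> takes values in \<open>(0, 1]\<close>. Where \<open>p = b = P \<le> 1\<close>, the bounds \<open>W - 1 \<le> P\<close> and
    \<open>W\<^sup>2 \<le> 2\<close> give \<open>- p' \<le> (4 L + 2 / a) P < K P = - b'\<close>.\<close>
  define K where "K = 4 * L + 2 / a + 1"
  define e where "e = min 1 (p a / 2)"
  have e: "0 < e" "e \<le> 1" "e < p a"
    using \<open>p a > 0\<close> by (auto simp: e_def)
  have "K > 0"
    using assms L by (auto simp: K_def add_nonneg_pos)
  define W where "W x = sqrt (1 + (p x)\<^sup>2)" for x
  define b where "b x = e * exp (- K * (x - a))" for x
  define p' where "p' x = (1 + (p x)\<^sup>2) * (2 * W x * h (1 / W x) - p x / x)" for x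
  have "p x - b x > 0"
  proof (rule positive_if_increasing_at_zeros[where a = a and g = "\<lambda>x. p x - b x" and g' = "\<lambda>x. p' x + K * b x"])
    fix x assume "a \<le> x"
    have "(b has_real_derivative - K * b x) (at x)"
      unfolding b_def by (auto intro!: derivative_eq_intros)
    moreover have "(p has_real_derivative p' x) (at x)"
      using ode \<open>a \<le> x\<close> \<open>r0 < a\<close> by (auto simp: slope_equation_def slope_field_def p'_def W_def)
    ultimately show "((\<lambda>x. p x - b x) has_real_derivative p' x + K * b x) (at x)"
      by (auto intro!: derivative_eq_intros)
    assume "p x - b x = 0"
    define P where "P = p x"
    have b: "b x = P" and P: "0 < P" "P \<le> 1"
      using \<open>p x - b x = 0\<close> e \<open>K > 0\<close> \<open>a \<le> x\<close> 
      by (auto simp: b_def P_def intro!: mult_le_one)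
    define w where "w = W x"
    have w: "w\<^sup>2 = 1 + P\<^sup>2" "w \<ge> 1"
      by (auto simp: w_def W_def P_def)
    have "P\<^sup>2 \<le> 1"
      using P by (simp add: power_le_one)
    have "w\<^sup>2 \<le> (1 + P)\<^sup>2"
      using P unfolding w(1) by (simp add: power2_sum)
    then have "w \<le> 1 + P"
      using P by (intro power2_le_imp_le[of w]) auto
    have "- h (1 / w) \<le> L * (1 - 1 / w)"
      using L w by auto
    then have "w * (- h (1 / w)) \<le> w * (L * (1 - 1 / w))"
      using w by (intro mult_left_mono) auto
    also have "\<dots> = L * (w - 1)"
      using w by (simp add: field_simps)
    also have "\<dots> \<le> L * P"
      using L \<open>w \<le> 1 + P\<close> by (intro mult_left_mono) auto
    finally have *: "- (w * h (1 / w)) \<le> L * P"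
      by simp
    have "P / x \<le> P / a"
      using P \<open>a \<le> x\<close> assms by (intro divide_left_mono) auto
    with * have **: "- (2 * w * h (1 / w) - P / x) \<le> 2 * L * P + P / a"
      by simp
    have "(1 + P\<^sup>2) * (- (2 * w * h (1 / w) - P / x)) \<le> (1 + P\<^sup>2) * (2 * L * P + P / a)"
      using ** by (intro mult_left_mono) auto
    also have "\<dots> \<le> 2 * (2 * L * P + P / a)"
      using \<open>P\<^sup>2 \<le> 1\<close> P L assms by (intro mult_right_mono) auto
    also have "\<dots> = K * P - P"
      by (simp add: K_def algebra_simps)
    finally have "- p' x \<le> K * P - P"
      by (simp only: p'_def P_def w_def minus_mult_right)
    then show "p' x + K * b x > 0"
      using P b by simp
  qed (use e assms in \<open>auto simp: b_def\<close>)
  moreover have "b x > 0"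
    using e by (simp add: b_def)
  ultimately show ?thesis
    by simp
qed

text \<open>As \<open>h \<le> 0\<close>, the equation gives \<open>p' \<le> - (1 + p\<^sup>2) p / x \<le> - p / x\<close>, that is \<open>(x p)' \<le> 0\<close>, so
  \<open>p\<close> is \<open>O(1/x)\<close>.\<close>

lemma slope_tendsto_0:
  assumes ode: "slope_equation h r0 p" and h: "prescribes_near_1 h"
    and "0 < r0" and pos: "\<And>x. x > r0 \<Longrightarrow> p x > 0"
  shows "(p \<longlongrightarrow> 0) at_top"
proof -
  define a where "a = r0 + 1"
  have "x * p x \<le> a * p a" if "x \<ge> a" for x
  proof (rule DERIV_nonpos_imp_nonincreasing[OF that])
    fix t assume t: "a \<le> t" "t \<le> x"
    define P where "P = p t"
    define w where "w = sqrt (1 + P\<^sup>2)"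
    define P' where "P' = (1 + P\<^sup>2) * (2 * w * h (1 / w) - P / t)"
    have P: "P > 0" and "t > 0"
      using pos t assms by (auto simp: P_def a_def)
    have "1 / w \<in> {0<..<1}"
      unfolding w_def using P by (intro normal_height_in_interval) auto
    then have "h (1 / w) < 0"
      using h by (auto simp: prescribes_near_1_def)
    moreover have "w > 0"
      by (auto simp: w_def add_pos_nonneg)
    ultimately have "w * h (1 / w) \<le> 0"
      by (simp add: mult_nonneg_nonpos)
    then have "P' \<le> (1 + P\<^sup>2) * (- P / t)"
      unfolding P'_def by (intro mult_left_mono) auto
    also have "\<dots> \<le> - P / t"
      using P \<open>t > 0\<close> by (simp add: field_simps)
    finally have "t * P' + P \<le> 0"
      using \<open>t > 0\<close> by (simp add: field_simps)
    moreover have "(p has_real_derivative P') (at t)"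
      using ode t by (auto simp: slope_equation_def slope_field_def P'_def w_def P_def a_def)
    then have "((\<lambda>t. t * p t) has_real_derivative t * P' + P) (at t)"
      by (auto intro!: derivative_eq_intros simp: P_def)
    ultimately show "\<exists>y. ((\<lambda>t. t * p t) has_real_derivative y) (at t) \<and> y \<le> 0"
      by blast
  qed
  then have bound: "p x \<le> a * p a / x" if "x \<ge> a" for x
    using that assms by (simp add: a_def field_simps)
  show ?thesis
  proof (rule tendsto_sandwich)
    show "\<forall>\<^sub>F x in at_top. 0 \<le> p x"
      using eventually_gt_at_top[of r0] by eventually_elim (use pos in \<open>auto intro: less_imp_le\<close>)
    show "\<forall>\<^sub>F x in at_top. p x \<le> a * p a / x"
      using eventually_ge_at_top[of a] by eventually_elim (use bound in auto)
    show "((\<lambda>x. a * p a / x) \<longlongrightarrow> 0) at_top"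
      by (intro tendsto_divide_0[OF tendsto_const] filterlim_at_top_imp_at_infinity filterlim_ident)
  qed auto
qed

text \<open>If \<open>q\<close> solves the equation for \<open>k\<close>, then \<open>x \<mapsto> q (m x)\<close> solves the one for \<open>m k\<close>: shrinking a surface
  by the factor \<open>m\<close> multiplies its mean curvature by \<open>m\<close> and keeps its slopes. One choice of a large
  \<open>m\<close> does two things. It makes \<open>m k \<le> c k < h\<close> for nearly vertical normals, so that the rescaled slope
  decreases faster than \<open>p\<close> wherever the two agree; and, as \<open>q\<close> tends to \<open>0\<close>, it puts the rescaled slope
  below \<open>p\<close> at the starting point.\<close>

lemma slope_comparison:
  assumes ode: "slope_equation h r0 p" "slope_equation k r0 q"
    and hk: "prescribes_near_1 h" "prescribes_near_1 k"
    and "0 < r0" and pos: "\<And>x. x > r0 \<Longrightarrow> p x > 0" "\<And>x. x > r0 \<Longrightarrow> q x > 0"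
    and dom: "\<forall>\<^sub>F y in at_left 1. h y > c * k y"
  obtains x0 m where "x0 > r0" "m \<ge> 1" "\<And>x. x \<ge> x0 \<Longrightarrow> q (m * x) < p x"
proof -
  define W where "W x = sqrt (1 + (p x)\<^sup>2)" for x
  have p0: "(p \<longlongrightarrow> 0) at_top"
    using slope_tendsto_0[OF ode(1) hk(1)] assms by blast
  have q0: "(q \<longlongrightarrow> 0) at_top"
    using slope_tendsto_0[OF ode(2) hk(2)] assms by blast
  have W: "1 / W x \<in> {0<..<1}" if "x > r0" for x
    unfolding W_def using pos(1)[OF that] by (intro normal_height_in_interval) auto
  have "((\<lambda>x. 1 / W x) \<longlongrightarrow> 1 / sqrt (1 + 0\<^sup>2)) at_top"
    unfolding W_def by (intro tendsto_intros p0) auto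
  moreover have "\<forall>\<^sub>F x in at_top. 1 / W x \<in> {..<1} \<and> 1 / W x \<noteq> 1"
    using eventually_gt_at_top[of r0] by eventually_elim (use W in fastforce)
  ultimately have "filterlim (\<lambda>x. 1 / W x) (at_left 1) at_top"
    by (simp add: filterlim_at)
  with dom have "\<forall>\<^sub>F x in at_top. h (1 / W x) > c * k (1 / W x)"
    by (auto simp: filterlim_iff)
  then have "\<forall>\<^sub>F x in at_top. x > r0 \<and> h (1 / W x) > c * k (1 / W x)"
    using eventually_gt_at_top[of r0] by eventually_elim auto
  then obtain x0 where x0: "\<And>x. x \<ge> x0 \<Longrightarrow> x > r0 \<and> h (1 / W x) > c * k (1 / W x)"
    by (auto simp: eventually_at_top_linorder)
  have "x0 > r0"
    using x0 by auto
  have "filterlim (\<lambda>m. m * x0) at_top at_top"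
    using \<open>x0 > r0\<close> \<open>0 < r0\<close>
    by (intro filterlim_at_top_mult_tendsto_pos[OF tendsto_const] filterlim_ident) auto
  then have "((\<lambda>m. q (m * x0)) \<longlongrightarrow> 0) at_top"
    by (rule filterlim_compose[OF q0])
  moreover have "p x0 > 0"
    using pos \<open>x0 > r0\<close> by auto
  ultimately have "\<forall>\<^sub>F m in at_top. q (m * x0) < p x0"
    by (auto dest: order_tendstoD)
  then have "\<forall>\<^sub>F m in at_top. q (m * x0) < p x0 \<and> m \<ge> 1 \<and> m \<ge> c"
    using eventually_ge_at_top[of 1] eventually_ge_at_top[of c] by eventually_elim auto
  then obtain m where m: "q (m * x0) < p x0" "m \<ge> 1" "m \<ge> c"
    by (auto simp: eventually_at_top_linorder)
  have "p x - q (m * x) > 0" if "x \<ge> x0" for x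
  proof (rule positive_if_increasing_at_zeros[OF _ _ _ that, where g = "\<lambda>x. p x - q (m * x)"
        and g' = "\<lambda>x. slope_field h x (p x) - slope_field k (m * x) (q (m * x)) * m"])
    fix x assume "x0 \<le> x"
    then have x: "r0 < x" "0 < x" "r0 < m * x"
      using x0 \<open>0 < r0\<close> m(2) mult_right_mono[of 1 m x] by force+
    have "((\<lambda>x. q (m * x)) has_real_derivative slope_field k (m * x) (q (m * x)) * m) (at x)"
      using ode(2) x
      by (intro DERIV_chain2[where f = q]) (auto intro!: derivative_eq_intros simp: slope_equation_def)
    then show "((\<lambda>x. p x - q (m * x)) has_real_derivative
        slope_field h x (p x) - slope_field k (m * x) (q (m * x)) * m) (at x)"
      using ode(1) x by (auto intro!: derivative_eq_intros simp: slope_equation_def)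
    assume "p x - q (m * x) = 0"
    then have eq: "q (m * x) = p x"
      by simp
    have "k (1 / W x) < 0"
      using W[OF x(1)] hk(2) by (auto simp: prescribes_near_1_def)
    then have "m * k (1 / W x) \<le> c * k (1 / W x)"
      using m(3) by (simp add: mult_right_mono_neg)
    also have "\<dots> < h (1 / W x)"
      using x0 \<open>x0 \<le> x\<close> by blast
    finally have "0 < (1 + (p x)\<^sup>2) * (2 * W x * (h (1 / W x) - m * k (1 / W x)))"
      by (auto simp: W_def add_pos_nonneg)
    \<comment> \<open>The two terms with \<open>p x / x\<close> cancel: this part of the equation is invariant under scaling.\<close>
    also have "\<dots> = (1 + (p x)\<^sup>2) * (2 * W x * h (1 / W x) - p x / x) -
        (1 + (p x)\<^sup>2) * (2 * W x * k (1 / W x) - p x / (m * x)) * m"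
      using x m by (simp add: field_simps)
    finally show "0 < slope_field h x (p x) - slope_field k (m * x) (q (m * x)) * m"
      by (simp add: eq W_def slope_field_def)
  qed (use m in auto)
  then show ?thesis
    using that \<open>x0 > r0\<close> m by (metis diff_gt_0_iff_gt)
qed

definition height_profile :: "(real \<Rightarrow> real) \<Rightarrow> real \<Rightarrow> (real \<Rightarrow> real) \<Rightarrow> bool" where
  "height_profile h r0 f \<longleftrightarrow>
     (\<forall>x>r0. f x > 0) \<and> (f \<longlongrightarrow> 0) (at_right r0) \<and>
     (\<exists>p. (\<forall>x>r0. (f has_real_derivative p x) (at x)) \<and> slope_equation h r0 p)"

text \<open>Since \<open>f\<close> is positive and tends to \<open>0\<close> at the waist, it has points of positive slope
  arbitrarily close to the waist, and from there on the slope stays positive.\<close>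

lemma height_profile_slope:
  assumes "height_profile h r0 f" and "prescribes_near_1 h" and "0 < r0"
  obtains p where "slope_equation h r0 p"
    and "\<And>x. x > r0 \<Longrightarrow> (f has_real_derivative p x) (at x)" and "\<And>x. x > r0 \<Longrightarrow> p x > 0"
proof -
  obtain p where p: "slope_equation h r0 p" 
    and f: "\<And>x. x > r0 \<Longrightarrow> (f has_real_derivative p x) (at x)"
    and f0: "\<And>x. x > r0 \<Longrightarrow> f x > 0" "(f \<longlongrightarrow> 0) (at_right r0)"
    using assms(1) by (auto simp: height_profile_def)
  have "p x > 0" if "x > r0" for x
  proof -
    have "\<forall>\<^sub>F y in at_right r0. f y < f x"
      using f0 that by (auto dest: order_tendstoD)
    moreover have "\<forall>\<^sub>F y in at_right r0. y \<in> {r0<..<x}"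
      using that by (rule eventually_at_right_real)
    ultimately have "\<forall>\<^sub>F y in at_right r0. f y < f x \<and> y \<in> {r0<..<x}"
      by eventually_elim auto
    then obtain y where y: "f y < f x" "r0 < y" "y < x"
      using eventually_happens'[OF trivial_limit_at_right_real] by fastforce
    obtain a where a: "y < a" "a < x" "f x - f y = (x - y) * p a"
      using MVT2[OF y(3), of f p] f y(2) by force
    then have "p a > 0"
      using y by (metis diff_gt_0_iff_gt zero_less_mult_pos)
    then show ?thesis
      using slope_positive[OF p assms(2,3), of a x] a y by auto
  qed
  with p f show ?thesis
    using that by blast
qed

text \<open>Integrating \<open>q (m x) < p x\<close> bounds \<open>g (m x)\<close> by \<open>m f x\<close> up to a constant for large \<open>x\<close>. As \<open>g\<close> is
  positive and increasing, an upper bound far out bounds it on all of \<open>(r0, \<infinity>)\<close>.\<close>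

lemma bounded_height_if_dominated:
  assumes f: "height_profile h r0 f" and g: "height_profile k r0 g"
    and hk: "prescribes_near_1 h" "prescribes_near_1 k" and "0 < r0"
    and dom: "\<forall>\<^sub>F y in at_left 1. h y > c * k y"
    and bdd: "bounded (f ` {r0<..})"
  shows "bounded (g ` {r0<..})"
proof -
  obtain p where p: "slope_equation h r0 p" "\<And>x. x > r0 \<Longrightarrow> (f has_real_derivative p x) (at x)"
    "\<And>x. x > r0 \<Longrightarrow> p x > 0"
    using height_profile_slope[OF f hk(1) \<open>0 < r0\<close>] by blast
  obtain q where q: "slope_equation k r0 q" "\<And>x. x > r0 \<Longrightarrow> (g has_real_derivative q x) (at x)"
    "\<And>x. x > r0 \<Longrightarrow> q x > 0"
    using height_profile_slope[OF g hk(2) \<open>0 < r0\<close>] by blast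
  obtain x0 m where m: "x0 > r0" "m \<ge> 1" and less: "\<And>x. x \<ge> x0 \<Longrightarrow> q (m * x) < p x"
    using slope_comparison[OF p(1) q(1) hk \<open>0 < r0\<close> p(3) q(3) dom] by blast
  obtain B where B: "\<And>x. x > r0 \<Longrightarrow> \<bar>f x\<bar> \<le> B"
    using bdd by (auto simp: bounded_iff)
  have mono: "g x \<le> g y" if "r0 < x" "x \<le> y" for x y
  proof (rule DERIV_nonneg_imp_nondecreasing[OF that(2)])
    fix t assume "x \<le> t"
    with that have "r0 < t"
      by simp
    then show "\<exists>d. (g has_real_derivative d) (at t) \<and> 0 \<le> d"
      using q by (meson less_imp_le)
  qed
  have *: "g (m * x) - m * f x \<le> g (m * x0) - m * f x0" if "x0 \<le> x" for x
    using that
  proof (rule DERIV_nonpos_imp_nonincreasing)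
    fix t assume t: "x0 \<le> t" "t \<le> x"
    then have "r0 < t" "r0 < m * t"
      using m \<open>0 < r0\<close> mult_right_mono[of 1 m t] by linarith+
    then have "((\<lambda>t. g (m * t)) has_real_derivative q (m * t) * m) (at t)"
      by (intro DERIV_chain2[where f = g] q) (auto intro!: derivative_eq_intros)
    then have "((\<lambda>t. g (m * t) - m * f t) has_real_derivative q (m * t) * m - m * p t) (at t)"
      using p(2)[OF \<open>r0 < t\<close>] by (auto intro!: derivative_eq_intros)
    moreover have "q (m * t) * m - m * p t \<le> 0"
      using less[OF t(1)] m by simp
    ultimately show "\<exists>y. ((\<lambda>t. g (m * t) - m * f t) has_real_derivative y) (at t) \<and> y \<le> 0"
      by blast
  qed
  have "\<bar>g y\<bar> \<le> g (m * x0) - m * f x0 + m * B" if "y > r0" for y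
  proof -
    define x where "x = max x0 y"
    have x: "x \<ge> x0" "x > r0" "x \<le> m * x"
      using that m \<open>0 < r0\<close> mult_right_mono[of 1 m x] by (auto simp: x_def)
    have "g y \<le> g (m * x)"
      using that x by (intro mono) (auto simp: x_def)
    also have "\<dots> \<le> g (m * x0) - m * f x0 + m * f x"
      using *[OF x(1)] by simp
    also have "\<dots> \<le> g (m * x0) - m * f x0 + m * B"
      using B[OF x(2)] m by (simp add: abs_le_iff)
    finally show ?thesis
      using g that by (force simp: height_profile_def)
  qed
  then show ?thesis
    by (auto simp: bounded_iff)
qed

text \<open>Both functions are negative, so \<open>h / k < C + 1\<close> near \<open>1\<close> means \<open>h > (C + 1) k\<close>.\<close>

lemma bounded_height_if_ratio_tendsto:
  assumes "height_profile h r0 f" and "height_profile k r0 g"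
    and hk: "prescribes_near_1 h" "prescribes_near_1 k" and "0 < r0"
    and lim: "((\<lambda>y. h y / k y) \<longlongrightarrow> C) (at_left 1)"
    and bdd: "bounded (f ` {r0<..})"
  shows "bounded (g ` {r0<..})"
proof (rule bounded_height_if_dominated[OF assms(1-5) _ bdd, where c = "C + 1"])
  have "\<forall>\<^sub>F y in at_left 1. h y / k y < C + 1"
    using lim by (rule order_tendstoD) simp
  moreover have "\<forall>\<^sub>F y in at_left 1. y \<in> {0<..<1 :: real}"
    by (rule eventually_at_left_real) simp
  ultimately show "\<forall>\<^sub>F y in at_left 1. h y > (C + 1) * k y"
  proof eventually_elim
    case (elim y)
    then have "k y < 0"
      using hk(2) by (auto simp: prescribes_near_1_def)
    with elim show ?case
      by (simp add: neg_divide_less_eq)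
  qed
qed

lemma bounded_height_iff_if_ratio_tendsto:
  assumes "height_profile h r0 f" and "height_profile k r0 g"
    and "prescribes_near_1 h" "prescribes_near_1 k" and "0 < r0"
    and lim: "((\<lambda>y. h y / k y) \<longlongrightarrow> C) (at_left 1)" and "C \<noteq> 0"
  shows "bounded (f ` {r0<..}) \<longleftrightarrow> bounded (g ` {r0<..})"
proof -
  have "((\<lambda>y. k y / h y) \<longlongrightarrow> inverse C) (at_left 1)"
    using tendsto_inverse[OF lim \<open>C \<noteq> 0\<close>] by simp
  then show ?thesis
    using bounded_height_if_ratio_tendsto assms by metis
qed

section \<open>Mean curvature of a rotated graph\<close>

lemma has_derivative_vector_3:
  assumes "(a has_derivative a') F" "(b has_derivative b') F" "(c has_derivative c') F"
  shows "((\<lambda>q. vector [a q, b q, c q] :: real ^ 3) has_derivative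
          (\<lambda>v. vector [a' v, b' v, c' v])) F"
proof -
  have *: "(vector [x, y, z] :: real ^ 3) = x *\<^sub>R axis 1 1 + y *\<^sub>R axis 2 1 + z *\<^sub>R axis 3 1" for x y z
    by (simp add: vec_eq_iff forall_3 axis_def)
  show ?thesis
    unfolding * by (intro derivative_intros assms)
qed

lemma continuous_on_vector_3:
  assumes "continuous_on S a" "continuous_on S b" "continuous_on S c"
  shows "continuous_on S (\<lambda>q. vector [a q, b q, c q] :: real ^ 3)"
proof -
  have *: "(vector [x, y, z] :: real ^ 3) = x *\<^sub>R axis 1 1 + y *\<^sub>R axis 2 1 + z *\<^sub>R axis 3 1" for x y z
    by (simp add: vec_eq_iff forall_3 axis_def)
  show ?thesis
    unfolding * by (intro continuous_intros assms)
qed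

lemma inner_vector_3: "(v :: real ^ 3) \<bullet> vector [a, b, c] = v $ 1 * a + v $ 2 * b + v $ 3 * c"
  by (simp add: inner_vec_def sum_3)

lemma partial_derivatives_of_local_eq:
  assumes "open U" "q \<in> U" and "\<And>q. q \<in> U \<Longrightarrow> X q = Y q" and "(Y has_derivative D) (at q)"
  shows "(X has_derivative D) (at q)" "pd1 X q = D (1, 0)" "pd2 X q = D (0, 1)"
proof -
  show *: "(X has_derivative D) (at q)"
    using has_derivative_transform_within_open[OF assms(4,1,2)] assms(3) by simp
  show "pd1 X q = D (1, 0)" "pd2 X q = D (0, 1)"
    using frechet_derivative_at[OF *] by (simp_all add: pd1_def pd2_def)
qed

text \<open>Half of the circle of angles suffices: by symmetry the mean curvature is needed only along the
  meridian of angle \<open>0\<close>. On this half the angle is recovered continuously as an arctangent.\<close>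

definition polar_domain :: "real \<Rightarrow> (real \<times> real) set" where
  "polar_domain r0 = {r0<..} \<times> {- pi / 2<..<pi / 2}"

definition polar_chart :: "(real \<Rightarrow> real) \<Rightarrow> real \<times> real \<Rightarrow> real ^ 3" where
  "polar_chart f q = vector [fst q * cos (snd q), fst q * sin (snd q), f (fst q)]"

lemma open_polar_domain: "open (polar_domain r0)"
  by (simp add: polar_domain_def open_Times)

context
  fixes r0 :: real and f p p' :: "real \<Rightarrow> real"
  assumes r0: "0 < r0"
    and f: "\<And>x. x > r0 \<Longrightarrow> (f has_real_derivative p x) (at x)"
    and p: "\<And>x. x > r0 \<Longrightarrow> (p has_real_derivative p' x) (at x)"
    and p': "continuous_on {r0<..} p'"
begin

lemma has_derivative_radial:
  assumes "q \<in> polar_domain r0"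
  shows "((\<lambda>q. f (fst q)) has_derivative (\<lambda>v. fst v * p (fst q))) (at q)"
    and "((\<lambda>q. p (fst q)) has_derivative (\<lambda>v. fst v * p' (fst q))) (at q)"
proof -
  have "fst q > r0"
    using assms by (auto simp: polar_domain_def)
  from has_derivative_compose[OF has_derivative_fst[OF has_derivative_ident]
      f[OF this, unfolded has_field_derivative_def]]
       has_derivative_compose[OF has_derivative_fst[OF has_derivative_ident]
      p[OF this, unfolded has_field_derivative_def]]
  show "((\<lambda>q. f (fst q)) has_derivative (\<lambda>v. fst v * p (fst q))) (at q)"
    and "((\<lambda>q. p (fst q)) has_derivative (\<lambda>v. fst v * p' (fst q))) (at q)"
    by (simp_all add: mult.commute)
qed

lemma polar_chart_derivative:
  assumes "q \<in> polar_domain r0"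
  shows "(polar_chart f has_derivative
      (\<lambda>v. vector [fst v * cos (snd q) - fst q * sin (snd q) * snd v,
                   fst v * sin (snd q) + fst q * cos (snd q) * snd v, p (fst q) * fst v])) (at q)"
  unfolding polar_chart_def
  by (rule has_derivative_vector_3)
     (auto intro!: derivative_eq_intros has_derivative_radial assms simp: algebra_simps)

lemma polar_chart_pd:
  assumes "q \<in> polar_domain r0"
  shows "pd1 (polar_chart f) q = vector [cos (snd q), sin (snd q), p (fst q)]"
    and "pd2 (polar_chart f) q = vector [- fst q * sin (snd q), fst q * cos (snd q), 0]"
  using partial_derivatives_of_local_eq[OF open_polar_domain assms refl polar_chart_derivative[OF assms]]
  by simp_all

lemma polar_chart_pd_derivative:
  assumes "q \<in> polar_domain r0"
  shows "((\<lambda>q. vector [cos (snd q), sin (snd q), p (fst q)] :: real ^ 3) has_derivative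
      (\<lambda>v. vector [- sin (snd q) * snd v, cos (snd q) * snd v, p' (fst q) * fst v])) (at q)"
    and "((\<lambda>q. vector [- fst q * sin (snd q), fst q * cos (snd q), 0] :: real ^ 3) has_derivative
      (\<lambda>v. vector [- fst v * sin (snd q) - fst q * cos (snd q) * snd v,
                   fst v * cos (snd q) - fst q * sin (snd q) * snd v, 0])) (at q)"
  by (rule has_derivative_vector_3,
      auto intro!: derivative_eq_intros has_derivative_radial assms simp: algebra_simps)+

lemma polar_chart_pd_pd:
  assumes "q \<in> polar_domain r0"
  shows "pd1 (pd1 (polar_chart f)) q = vector [0, 0, p' (fst q)]"
    and "pd2 (pd1 (polar_chart f)) q = vector [- sin (snd q), cos (snd q), 0]"
    and "pd1 (pd2 (polar_chart f)) q = vector [- sin (snd q), cos (snd q), 0]"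
    and "pd2 (pd2 (polar_chart f)) q = vector [- fst q * cos (snd q), - fst q * sin (snd q), 0]"
    and "pd1 (polar_chart f) differentiable (at q)"
    and "pd2 (polar_chart f) differentiable (at q)"
  using partial_derivatives_of_local_eq[OF open_polar_domain assms polar_chart_pd(1)
      polar_chart_pd_derivative(1)[OF assms]]
    partial_derivatives_of_local_eq[OF open_polar_domain assms polar_chart_pd(2)
      polar_chart_pd_derivative(2)[OF assms]]
  by (auto simp: differentiable_def)

lemma C2_polar_chart: "C2_map_on (polar_domain r0) (polar_chart f)"
proof -
  let ?U = "polar_domain r0"
  have "continuous_on ?U (\<lambda>q. p' (fst q))"
    by (rule continuous_on_compose2[OF p']) (auto intro!: continuous_intros simp: polar_domain_def)
  then have "continuous_on ?U (pd1 (pd1 (polar_chart f)))" "continuous_on ?U (pd2 (pd1 (polar_chart f)))"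
    "continuous_on ?U (pd1 (pd2 (polar_chart f)))" "continuous_on ?U (pd2 (pd2 (polar_chart f)))"
    by (simp_all add: polar_chart_pd_pd(1-4) continuous_on_vector_3 continuous_intros
        cong: continuous_on_cong_simp)
  moreover have "polar_chart f differentiable (at q)" if "q \<in> ?U" for q
    using polar_chart_derivative[OF that] by (rule differentiableI)
  ultimately show ?thesis
    unfolding C2_map_on_def differentiable_on_def
    using polar_chart_pd_pd(5,6) by (blast intro: differentiable_at_withinI)
qed

lemma polar_chart_immersion:
  assumes "q \<in> polar_domain r0"
  shows "inj (frechet_derivative (polar_chart f) (at q))"
proof -
  define D where "D = frechet_derivative (polar_chart f) (at q)"
  have D: "D v = vector [fst v * cos (snd q) - fst q * sin (snd q) * snd v,
      fst v * sin (snd q) + fst q * cos (snd q) * snd v, p (fst q) * fst v]" for v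
    unfolding D_def frechet_derivative_at[OF polar_chart_derivative[OF assms], symmetric] ..
  have "linear D"
    unfolding D_def
    by (rule linear_frechet_derivative) (use polar_chart_derivative[OF assms] in \<open>auto intro: differentiableI\<close>)
  moreover have "v = 0" if "D v = 0" for v
  proof -
    let ?c = "cos (snd q)" and ?s = "sin (snd q)"
    have 1: "fst v * ?c - fst q * ?s * snd v = 0"
      and 2: "fst v * ?s + fst q * ?c * snd v = 0"
      using that unfolding D by (auto simp: vec_eq_iff forall_3)
    have "fst v = fst v * (?c\<^sup>2 + ?s\<^sup>2)"
      by simp
    also have "\<dots> = ?c * (fst v * ?c - fst q * ?s * snd v) + ?s * (fst v * ?s + fst q * ?c * snd v)"
      by algebra
    finally have "fst v = 0"
      using 1 2 by simp
    have "fst q * snd v = fst q * snd v * (?c\<^sup>2 + ?s\<^sup>2)"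
      by simp
    also have "\<dots> = ?c * (fst v * ?s + fst q * ?c * snd v) - ?s * (fst v * ?c - fst q * ?s * snd v)"
      by algebra
    finally have "fst q * snd v = 0"
      using 1 2 by simp
    moreover have "fst q > 0"
      using assms r0 by (auto simp: polar_domain_def)
    ultimately show "v = 0"
      using \<open>fst v = 0\<close> by (simp add: prod_eq_iff)
  qed
  ultimately show ?thesis
    by (simp add: linear_injective_0 flip: D_def)
qed

lemma axis_dist_polar_chart:
  assumes "q \<in> polar_domain r0"
  shows "axis_dist (polar_chart f q) = fst q"
proof -
  have "(fst q * cos (snd q))\<^sup>2 + (fst q * sin (snd q))\<^sup>2 = (fst q)\<^sup>2"
    by (simp add: power_mult_distrib flip: distrib_left)
  moreover have "fst q > 0"
    using assms r0 by (auto simp: polar_domain_def)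
  ultimately show ?thesis
    by (simp add: axis_dist_def polar_chart_def)
qed

lemma polar_chart_image:
  "polar_chart f ` polar_domain r0 = rotated_graph r0 f \<inter> {x. x $ 1 > 0}"
proof (intro equalityI subsetI)
  fix y assume "y \<in> polar_chart f ` polar_domain r0"
  then obtain q where q: "q \<in> polar_domain r0" "y = polar_chart f q"
    by auto
  then have "fst q > r0" "cos (snd q) > 0"
    by (auto simp: polar_domain_def intro: cos_gt_zero_pi)
  then show "y \<in> rotated_graph r0 f \<inter> {x. x $ 1 > 0}"
    using axis_dist_polar_chart[OF q(1)] q(2) r0
    by (simp add: rotated_graph_def) (simp add: polar_chart_def)
next
  fix y assume "y \<in> rotated_graph r0 f \<inter> {x. x $ 1 > 0}"
  then have y: "axis_dist y > r0" "y $ 3 = f (axis_dist y)" "y $ 1 > 0"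
    by (auto simp: rotated_graph_def)
  define t where "t = arctan (y $ 2 / y $ 1)"
  have "(y $ 1)\<^sup>2 * (1 + (y $ 2 / y $ 1)\<^sup>2) = (y $ 1)\<^sup>2 + (y $ 2)\<^sup>2"
    using y(3) by (simp add: field_simps)
  then have "axis_dist y = sqrt ((y $ 1)\<^sup>2 * (1 + (y $ 2 / y $ 1)\<^sup>2))"
    by (simp add: axis_dist_def)
  also have "\<dots> = y $ 1 * sqrt (1 + (y $ 2 / y $ 1)\<^sup>2)"
    using y(3) by (simp add: real_sqrt_mult)
  finally have r: "axis_dist y = y $ 1 * sqrt (1 + (y $ 2 / y $ 1)\<^sup>2)" .
  have "sqrt (1 + (y $ 2 / y $ 1)\<^sup>2) > 0"
    by (simp add: add_pos_nonneg)
  then have "axis_dist y * cos t = y $ 1" "axis_dist y * sin t = y $ 2"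
    using y(3) by (simp_all add: t_def r cos_arctan sin_arctan)
  then have "y = polar_chart f (axis_dist y, t)"
    using y by (simp add: polar_chart_def vec_eq_iff forall_3)
  moreover have "(axis_dist y, t) \<in> polar_domain r0"
    using y arctan_bounded[of "y $ 2 / y $ 1"] by (simp add: polar_domain_def t_def)
  ultimately show "y \<in> polar_chart f ` polar_domain r0"
    by blast
qed

lemma polar_chart_homeomorphism:
  "homeomorphism (polar_domain r0) (polar_chart f ` polar_domain r0) (polar_chart f)
     (\<lambda>y. (axis_dist y, arctan (y $ 2 / y $ 1)))"
proof (rule homeomorphismI)
  show "continuous_on (polar_domain r0) (polar_chart f)"
    using C2_polar_chart differentiable_imp_continuous_on by (auto simp: C2_map_on_def)
  show "continuous_on (polar_chart f ` polar_domain r0) (\<lambda>y. (axis_dist y, arctan (y $ 2 / y $ 1)))"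
    unfolding polar_chart_image axis_dist_def by (intro continuous_intros) auto
  show inv: "(axis_dist (polar_chart f q), arctan (polar_chart f q $ 2 / polar_chart f q $ 1)) = q"
    if "q \<in> polar_domain r0" for q
  proof -
    have "fst q > 0" "- (pi / 2) < snd q" "snd q < pi / 2"
      using that r0 by (auto simp: polar_domain_def)
    then have "arctan (polar_chart f q $ 2 / polar_chart f q $ 1) = snd q"
      using arctan_tan[of "snd q"] by (simp add: polar_chart_def tan_def)
    then show ?thesis
      by (simp add: axis_dist_polar_chart[OF that])
  qed
  show "polar_chart f (axis_dist y, arctan (y $ 2 / y $ 1)) = y"
    if "y \<in> polar_chart f ` polar_domain r0" for y
    using that inv by force
  show "(\<lambda>y. (axis_dist y, arctan (y $ 2 / y $ 1))) ` polar_chart f ` polar_domain r0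
      \<subseteq> polar_domain r0"
    using inv by force
qed auto

lemma local_chart_polar_chart:
  assumes "open S" and "\<Sigma> \<inter> S = rotated_graph r0 f"
  shows "local_chart \<Sigma> (polar_domain r0) (polar_chart f)"
proof -
  have "open (S \<inter> {x :: real ^ 3. x $ 1 > 0})"
    using assms(1) by (intro open_Int open_Collect_less continuous_intros)
  moreover have "polar_chart f ` polar_domain r0 = \<Sigma> \<inter> (S \<inter> {x. x $ 1 > 0})"
    unfolding polar_chart_image assms(2)[symmetric] by blast
  ultimately have "openin (top_of_set \<Sigma>) (polar_chart f ` polar_domain r0)"
    by (auto simp: openin_open)
  then show ?thesis
    unfolding local_chart_def
    using open_polar_domain C2_polar_chart polar_chart_immersion polar_chart_homeomorphism by blast
qed

text \<open>The sign \<open>s\<close> is \<open>1\<close> where the normal points upwards and \<open>-1\<close> where it points downwards. At angle \<open>0\<close> the tangent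
  vectors are \<open>(1, 0, f')\<close> and \<open>(0, x, 0)\<close>, so with \<open>w = (1 + f'\<^sup>2)\<^bsup>1/2\<^esup>\<close> the normal has to be
  \<open>(- s f' / w, 0, s / w)\<close>. Both fundamental forms are diagonal, and comparing the coefficients of \<open>t\<close> in
  the polynomial identity that defines the principal curvatures gives their sum.\<close>

lemma rotated_graph_mean_curvature:
  assumes \<Sigma>: "open S" "\<Sigma> \<inter> S = rotated_graph r0 f" "H_surface \<H> \<Sigma> \<eta>"
    and s: "\<bar>s\<bar> = 1" and up: "\<And>y. y \<in> \<Sigma> \<inter> S \<Longrightarrow> s * (\<eta> y \<bullet> e3) > 0" and "x > r0"
  shows "2 * \<H> (s / sqrt (1 + (p x)\<^sup>2)) =
    s / sqrt (1 + (p x)\<^sup>2) * (p' x / (1 + (p x)\<^sup>2) + p x / x)"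
proof -
  define q where "q = (x, 0 :: real)"
  define n where "n = \<eta> (polar_chart f q)"
  define w where "w = sqrt (1 + (p x)\<^sup>2)"
  have q: "q \<in> polar_domain r0"
    using \<open>x > r0\<close> by (simp add: q_def polar_domain_def)
  have "x > 0"
    using \<open>x > r0\<close> r0 by simp
  have w: "w > 0" "w\<^sup>2 = 1 + (p x)\<^sup>2"
    by (auto simp: w_def add_pos_nonneg)
  note chart = local_chart_polar_chart[OF \<Sigma>(1,2)]
  have X: "polar_chart f q \<in> \<Sigma> \<inter> S"
    using q polar_chart_image unfolding \<Sigma>(2) by blast
  have n3: "n \<bullet> e3 = n $ 3"
    by (simp add: e3_def inner_vector_3)
  have pds: "pd1 (polar_chart f) q = vector [1, 0, p x]" "pd2 (polar_chart f) q = vector [0, x, 0]"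
    "pd1 (pd1 (polar_chart f)) q = vector [0, 0, p' x]"
    "pd2 (pd1 (polar_chart f)) q = vector [0, 1, 0]"
    "pd1 (pd2 (polar_chart f)) q = vector [0, 1, 0]"
    "pd2 (pd2 (polar_chart f)) q = vector [- x, 0, 0]"
    using polar_chart_pd[OF q] polar_chart_pd_pd[OF q] by (simp_all add: q_def)
  have "n \<bullet> pd1 (polar_chart f) q = 0" "n \<bullet> pd2 (polar_chart f) q = 0" and "norm n = 1"
    using \<Sigma>(3) chart q X by (auto simp: H_surface_def unit_normal_def n_def)
  then have n: "n $ 1 = - p x * n $ 3" "n $ 2 = 0" "(n $ 1)\<^sup>2 + (n $ 2)\<^sup>2 + (n $ 3)\<^sup>2 = 1"
    using \<open>x > 0\<close>
    by (auto simp: pds inner_vector_3 norm_eq_1 inner_vec_def sum_3 power2_eq_square mult.commute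
        eq_neg_iff_add_eq_0)
  then have "(w * n $ 3)\<^sup>2 = 1"
    by (simp add: power_mult_distrib w algebra_simps)
  moreover have "s * (w * n $ 3) > 0"
    using mult_pos_pos[OF w(1) up[OF X]] by (simp add: n3 mult.left_commute flip: n_def)
  moreover have "s = 1 \<or> s = - 1"
    using s by linarith
  ultimately have "w * n $ 3 = s"
    unfolding power2_eq_1_iff by auto
  then have n3s: "n $ 3 = s / w"
    using w by (simp add: field_simps)
  obtain k1 k2 where "principal_curvatures \<eta> (polar_chart f) q k1 k2"
    and H: "\<H> (n $ 3) = (k1 + k2) / 2"
    using \<Sigma>(3) chart q unfolding H_surface_def has_mean_curvature_def by (metis n_def n3)
  moreover have "first_form (polar_chart f) q = vector [vector [w\<^sup>2, 0], vector [0, x\<^sup>2]]"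
    by (simp add: first_form_def pds inner_vector_3 w(2)[unfolded power2_eq_square] power2_eq_square)
  moreover have "second_form \<eta> (polar_chart f) q =
      vector [vector [p' x * n $ 3, 0], vector [0, x * p x * n $ 3]]"
    using n(1,2)
    by (simp add: second_form_def pds trans[OF inner_commute inner_vector_3] ac_simps flip: n_def)
  ultimately have det: "(p' x * n $ 3 - t * w\<^sup>2) * (x * p x * n $ 3 - t * x\<^sup>2)
      = w\<^sup>2 * x\<^sup>2 * ((k1 - t) * (k2 - t))" for t
    by (simp add: principal_curvatures_def det_2)
  \<comment> \<open>Subtracting the identities at \<open>t = 1\<close> and \<open>t = -1\<close> isolates the coefficient of \<open>t\<close>.\<close>
  have "w\<^sup>2 * x\<^sup>2 * (k1 + k2) = p' x * n $ 3 * x\<^sup>2 + w\<^sup>2 * x * p x * n $ 3"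
    using det[of 1] det[of "-1"] by (simp add: algebra_simps)
  then have "x * (w\<^sup>2 * x * (k1 + k2) - (p' x * n $ 3 * x + w\<^sup>2 * p x * n $ 3)) = 0"
    by algebra
  then have "w\<^sup>2 * x * (k1 + k2) = p' x * n $ 3 * x + w\<^sup>2 * p x * n $ 3"
    using \<open>x > 0\<close> by simp
  then have "k1 + k2 = n $ 3 * (p' x / w\<^sup>2 + p x / x)"
    using w(1) \<open>x > 0\<close> by (simp add: field_simps power2_eq_square)
  then show ?thesis
    using H unfolding n3s w(2) by (simp add: w_def)
qed

end

section \<open>The ends of a catenoid\<close>

lemma prescribes_near_1_of_C1_class:
  assumes H: "\<H> \<in> C1_class" and s: "\<bar>s\<bar> = 1"
  shows "prescribes_near_1 (\<lambda>y. \<H> (s * y))"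
proof -
  obtain H' where H': "\<And>y. y \<in> {-1..1} \<Longrightarrow> (\<H> has_real_derivative H' y) (at y within {-1..1})"
    and cont: "continuous_on {-1..1} H'"
    and neg: "\<And>y. y \<in> {-1<..<1} \<Longrightarrow> \<H> y < 0" and zero: "\<H> (-1) = 0" "\<H> 1 = 0"
    using H unfolding C1_class_def by blast
  have s: "s = 1 \<or> s = -1"
    using s by linarith
  have "bounded (H' ` {-1..1})"
    using cont by (intro compact_imp_bounded compact_continuous_image) auto
  then obtain L where L: "L > 0" "\<And>y. y \<in> {-1..1} \<Longrightarrow> \<bar>H' y\<bar> \<le> L"
    by (auto simp: bounded_pos)
  have "- \<H> (s * y) \<le> L * (1 - y)" if "0 < y" "y \<le> 1" for y
  proof -
    have "norm (\<H> (s * y) - \<H> s) \<le> L * norm (s * y - s)"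
      using that s L by (intro field_differentiable_bound[OF _ H']) auto
    moreover have "\<H> s = 0" "\<bar>s * y - s\<bar> = 1 - y"
      using s zero that by auto
    ultimately show ?thesis
      by simp
  qed
  moreover have "\<H> (s * y) < 0" if "0 < y" "y < 1" for y
    using s that by (auto intro: neg)
  ultimately show ?thesis
    using L(1) by (auto simp: prescribes_near_1_def intro!: exI[of _ L])
qed

text \<open>The sign \<open>s\<close> treats both ends at once. On the lower end, where \<open>s = -1\<close>, reflection in the plane
  \<open>z = 0\<close> turns \<open>f\<close> into \<open>- f\<close>, and the prescribing function becomes \<open>y \<mapsto> \<H> (- y)\<close>.\<close>

lemma height_profile_of_rotated_graph:
  assumes "0 < r0" and C2: "C2_profile r0 f"
    and \<Sigma>: "open S" "\<Sigma> \<inter> S = rotated_graph r0 f" "H_surface \<H> \<Sigma> \<eta>"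
    and s: "\<bar>s\<bar> = 1" and normal: "\<And>y. y \<in> \<Sigma> \<inter> S \<Longrightarrow> s * (\<eta> y \<bullet> e3) > 0"
    and side: "\<And>y. y \<in> S \<Longrightarrow> s * y $ 3 > 0"
  shows "height_profile (\<lambda>y. \<H> (s * y)) r0 (\<lambda>x. s * f x)"
proof -
  have f: "(f has_real_derivative deriv f x) (at x)"
    and f': "(deriv f has_real_derivative deriv (deriv f) x) (at x)" if "x > r0" for x
    using C2 that differentiable_on_eq_differentiable_at[OF open_greaterThan[of r0]]
    by (auto simp: C2_profile_def DERIV_deriv_iff_real_differentiable)
  have cont: "continuous_on {r0<..} (deriv (deriv f))"
    using C2 by (simp add: C2_profile_def)
  have ss: "s * (s * a) = a" for a
    using s by (cases "s = 1") (auto simp: abs_if split: if_splits)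
  have s2: "s\<^sup>2 = 1"
    using ss[of 1] by (simp add: power2_eq_square)
  have "((\<lambda>x. s * deriv f x) has_real_derivative slope_field (\<lambda>y. \<H> (s * y)) x (s * deriv f x)) (at x)"
    if "x > r0" for x
  proof -
    define w where "w = sqrt (1 + (deriv f x)\<^sup>2)"
    have w: "w > 0" "w\<^sup>2 = 1 + (deriv f x)\<^sup>2"
      by (auto simp: w_def add_pos_nonneg)
    have H: "2 * \<H> (s / w) = s / w * (deriv (deriv f) x / w\<^sup>2 + deriv f x / x)"
      unfolding w(2) unfolding w_def
      by (rule rotated_graph_mean_curvature[OF \<open>0 < r0\<close> f f' cont \<Sigma> s normal that])
    have "w\<^sup>2 * (2 * w * \<H> (s / w) - s * deriv f x / x)
        = w\<^sup>2 * (w * (2 * \<H> (s / w)) - s * deriv f x / x)"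
      by (simp only: mult_ac)
    also have "\<dots> = s * (w\<^sup>2 * (deriv (deriv f) x / w\<^sup>2))"
      unfolding H using w(1) by (simp add: distrib_left right_diff_distrib)
    also have "\<dots> = s * deriv (deriv f) x"
      using w(1) by simp
    finally have eq: "w\<^sup>2 * (2 * w * \<H> (s / w) - s * deriv f x / x) = s * deriv (deriv f) x" .
    have slope: "((\<lambda>x. s * deriv f x) has_real_derivative s * deriv (deriv f) x) (at x)"
      using f'[OF that] by (rule DERIV_cmult)
    have "1 + (s * deriv f x)\<^sup>2 = w\<^sup>2"
      by (simp only: power_mult_distrib s2 w(2) mult_1)
    moreover have "sqrt (w\<^sup>2) = w"
      using w(1) by simp
    moreover have "s * (1 / w) = s / w"
      by simp
    ultimately have "slope_field (\<lambda>y. \<H> (s * y)) x (s * deriv f x) = s * deriv (deriv f) x"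
      unfolding slope_field_def using eq by presburger
    then show ?thesis
      using slope by (rule ssubst)
  qed
  then have "slope_equation (\<lambda>y. \<H> (s * y)) r0 (\<lambda>x. s * deriv f x)"
    unfolding slope_equation_def by blast
  moreover have "((\<lambda>x. s * f x) has_real_derivative s * deriv f x) (at x)" if "x > r0" for x
    using f[OF that] by (rule DERIV_cmult)
  moreover have "s * f x > 0" if "x > r0" for x
  proof -
    have "(vector [x, 0, f x] :: real ^ 3) \<in> rotated_graph r0 f"
      using that \<open>0 < r0\<close> by (simp add: rotated_graph_def axis_dist_def)
    then have "(vector [x, 0, f x] :: real ^ 3) \<in> S"
      using \<Sigma>(2) by blast
    from side[OF this] show ?thesis
      by simp
  qed
  moreover have "((\<lambda>x. s * f x) \<longlongrightarrow> 0) (at_right r0)"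
    using C2 tendsto_mult_right_zero unfolding C2_profile_def by blast
  ultimately show ?thesis
    unfolding height_profile_def by (intro conjI exI[of _ "\<lambda>x. s * deriv f x"]) simp_all
qed

lemma rotated_graph_eq_imp_eq:
  assumes "rotated_graph r0 f = rotated_graph r0 g" "r0 < x" "0 < r0"
  shows "f x = g x"
proof -
  have "(vector [x, 0, f x] :: real ^ 3) \<in> rotated_graph r0 g"
    unfolding assms(1)[symmetric] using assms(2,3) by (simp add: rotated_graph_def axis_dist_def)
  then show ?thesis
    using assms by (simp add: rotated_graph_def axis_dist_def)
qed

lemma bounded_signed_image_iff:
  fixes s :: real and f g :: "real \<Rightarrow> real"
  assumes "\<bar>s\<bar> = 1" and "\<And>x. x > r0 \<Longrightarrow> g x = f x"
  shows "bounded (g ` {r0<..}) \<longleftrightarrow> bounded ((\<lambda>x. s * f x) ` {r0<..})"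
  using assms by (auto simp: bounded_iff abs_mult)

text \<open>The heights are defined by the existence of some profile. Profiles of the same end agree on
  \<open>(r0, \<infinity>)\<close>, so one profile decides both boundedness and unboundedness.\<close>

lemma catenoid_upper_profile:
  assumes "H_catenoid \<H> r0 \<Sigma>" "0 < r0"
  obtains f where "height_profile \<H> r0 f"
    and "bounded_upper_height r0 \<Sigma> \<longleftrightarrow> bounded (f ` {r0<..})"
    and "unbounded_upper_height r0 \<Sigma> \<longleftrightarrow> \<not> bounded (f ` {r0<..})"
proof -
  obtain f \<eta> where f: "upper_profile r0 \<Sigma> f" "C2_profile r0 f"
    and \<eta>: "H_surface \<H> \<Sigma> \<eta>" "\<And>y. y \<in> \<Sigma> \<Longrightarrow> y $ 3 > 0 \<Longrightarrow> \<eta> y \<bullet> e3 > 0"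
    using assms(1) by (auto simp: H_catenoid_def)
  have "open {y :: real ^ 3. y $ 3 > 0}"
    by (intro open_Collect_less continuous_intros)
  then have "height_profile \<H> r0 f"
    using height_profile_of_rotated_graph[OF \<open>0 < r0\<close> f(2) _ f(1)[unfolded upper_profile_def] \<eta>(1), of 1]
      \<eta>(2) by simp
  moreover have "bounded (g ` {r0<..}) \<longleftrightarrow> bounded (f ` {r0<..})" if "upper_profile r0 \<Sigma> g" for g
    using bounded_signed_image_iff[of 1 r0 g f] rotated_graph_eq_imp_eq[of r0 g f] that f(1) assms(2)
    by (simp add: upper_profile_def)
  ultimately show ?thesis
    using that f(1) unfolding bounded_upper_height_def unbounded_upper_height_def by metis
qed

lemma catenoid_lower_profile:
  assumes "H_catenoid \<H> r0 \<Sigma>" "0 < r0"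
  obtains f where "height_profile (\<lambda>y. \<H> (- y)) r0 f"
    and "bounded_lower_height r0 \<Sigma> \<longleftrightarrow> bounded (f ` {r0<..})"
    and "unbounded_lower_height r0 \<Sigma> \<longleftrightarrow> \<not> bounded (f ` {r0<..})"
proof -
  obtain f \<eta> where f: "lower_profile r0 \<Sigma> f" "C2_profile r0 f"
    and \<eta>: "H_surface \<H> \<Sigma> \<eta>" "\<And>y. y \<in> \<Sigma> \<Longrightarrow> y $ 3 < 0 \<Longrightarrow> \<eta> y \<bullet> e3 < 0"
    using assms(1) by (auto simp: H_catenoid_def)
  have "open {y :: real ^ 3. y $ 3 < 0}"
    by (intro open_Collect_less continuous_intros)
  then have "height_profile (\<lambda>y. \<H> (- y)) r0 (\<lambda>x. - f x)"
    using height_profile_of_rotated_graph[OF \<open>0 < r0\<close> f(2) _ f(1)[unfolded lower_profile_def] \<eta>(1), of "-1"]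
      \<eta>(2) by simp
  moreover have "bounded (g ` {r0<..}) \<longleftrightarrow> bounded ((\<lambda>x. - f x) ` {r0<..})"
    if "lower_profile r0 \<Sigma> g" for g
    using bounded_signed_image_iff[of "-1" r0 g f] rotated_graph_eq_imp_eq[of r0 g f] that f(1) assms(2)
    by (simp add: lower_profile_def)
  ultimately show ?thesis
    using that f(1) unfolding bounded_lower_height_def unbounded_lower_height_def by metis
qed

theorem proposition3p4:
  fixes \<H> \<F> :: "real \<Rightarrow> real" and r0 :: real and \<Sigma>\<^sub>H \<Sigma>\<^sub>F :: "(real ^ 3) set"
  assumes "\<H> \<in> C1_class" and "\<F> \<in> C1_class" and "r0 > 0"
    and "H_catenoid \<H> r0 \<Sigma>\<^sub>H" and "H_catenoid \<F> r0 \<Sigma>\<^sub>F"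
  shows "(\<H> \<sim>\<^sub>1 \<F> \<longrightarrow>
            (bounded_upper_height r0 \<Sigma>\<^sub>H \<longleftrightarrow> bounded_upper_height r0 \<Sigma>\<^sub>F) \<and>
            (unbounded_upper_height r0 \<Sigma>\<^sub>H \<longleftrightarrow> unbounded_upper_height r0 \<Sigma>\<^sub>F)) \<and>
         (\<H> \<sim>\<^sub>-\<^sub>1 \<F> \<longrightarrow>
            (bounded_lower_height r0 \<Sigma>\<^sub>H \<longleftrightarrow> bounded_lower_height r0 \<Sigma>\<^sub>F) \<and>
            (unbounded_lower_height r0 \<Sigma>\<^sub>H \<longleftrightarrow> unbounded_lower_height r0 \<Sigma>\<^sub>F))"
proof (intro conjI impI)
  note near_1 = assms(1,2)[THEN prescribes_near_1_of_C1_class, of 1, simplified]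
  note near_m1 = assms(1,2)[THEN prescribes_near_1_of_C1_class, of "-1", simplified]
  {
    assume "\<H> \<sim>\<^sub>1 \<F>"
    then obtain C where C: "C \<noteq> 0" "((\<lambda>y. \<H> y / \<F> y) \<longlongrightarrow> C) (at_left 1)"
      by (auto simp: sim_1_def)
    obtain f where f: "height_profile \<H> r0 f"
      "bounded_upper_height r0 \<Sigma>\<^sub>H \<longleftrightarrow> bounded (f ` {r0<..})"
      "unbounded_upper_height r0 \<Sigma>\<^sub>H \<longleftrightarrow> \<not> bounded (f ` {r0<..})"
      using catenoid_upper_profile[OF assms(4,3)] .
    obtain g where g: "height_profile \<F> r0 g"
      "bounded_upper_height r0 \<Sigma>\<^sub>F \<longleftrightarrow> bounded (g ` {r0<..})"
      "unbounded_upper_height r0 \<Sigma>\<^sub>F \<longleftrightarrow> \<not> bounded (g ` {r0<..})"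
      using catenoid_upper_profile[OF assms(5,3)] .
    note iff = bounded_height_iff_if_ratio_tendsto[OF f(1) g(1) near_1 \<open>r0 > 0\<close> C(2,1)]
    show "bounded_upper_height r0 \<Sigma>\<^sub>H \<longleftrightarrow> bounded_upper_height r0 \<Sigma>\<^sub>F"
      "unbounded_upper_height r0 \<Sigma>\<^sub>H \<longleftrightarrow> unbounded_upper_height r0 \<Sigma>\<^sub>F"
      using f g iff by auto
  next
    assume "\<H> \<sim>\<^sub>-\<^sub>1 \<F>"
    then obtain C where C: "C \<noteq> 0" "((\<lambda>y. \<H> (- y) / \<F> (- y)) \<longlongrightarrow> C) (at_left 1)"
      by (auto simp: sim_m1_def filterlim_at_left_to_right)
    obtain f where f: "height_profile (\<lambda>y. \<H> (- y)) r0 f"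
      "bounded_lower_height r0 \<Sigma>\<^sub>H \<longleftrightarrow> bounded (f ` {r0<..})"
      "unbounded_lower_height r0 \<Sigma>\<^sub>H \<longleftrightarrow> \<not> bounded (f ` {r0<..})"
      using catenoid_lower_profile[OF assms(4,3)] .
    obtain g where g: "height_profile (\<lambda>y. \<F> (- y)) r0 g"
      "bounded_lower_height r0 \<Sigma>\<^sub>F \<longleftrightarrow> bounded (g ` {r0<..})"
      "unbounded_lower_height r0 \<Sigma>\<^sub>F \<longleftrightarrow> \<not> bounded (g ` {r0<..})"
      using catenoid_lower_profile[OF assms(5,3)] .
    note iff = bounded_height_iff_if_ratio_tendsto[OF f(1) g(1) near_m1 \<open>r0 > 0\<close> C(2,1)]
    show "bounded_lower_height r0 \<Sigma>\<^sub>H \<longleftrightarrow> bounded_lower_height r0 \<Sigma>\<^sub>F"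
      "unbounded_lower_height r0 \<Sigma>\<^sub>H \<longleftrightarrow> unbounded_lower_height r0 \<Sigma>\<^sub>F"
      using f g iff by auto
  }
qed

end
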